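(* Let $a<b$ be real numbers and let $\rho:[a,b]\to\mathbb{R}$ be a continuous function. Then $\rho$ has both an integral (over $[a,b]$) and an antiderivative (on $[a,b]$).
   Context: The integral is defined axiomatically: $\rho$ has an integral over $[a,b]$ if there is a function $I:[a,b]\times[a,b]\to\mathbb{R}$ satisfying (A) $I(x,y)+I(y,z)=I(x,z)$ for all $x,y,z\in[a,b]$, and (B) $I(x,x+h)=\rho(x)h+o(h)$ as $h\to0$ for all $x\in[a,b]$, i.e. $\lim_{h\to0}\frac{I(x,x+h)-\rho(x)h}{h}=0$, where $h\neq0$ ranges over values with $x+h\in[a,b]$ (one-sided limits at the endpoints). The number $I(a,b)$ is then called the integral of $\rho$ over $[a,b]$. An antiderivative of $\rho$ on $[a,b]$ is a function $R:[a,b]\to\mathbb{R}$ with $R'(x)=\rho(x)$ for all $x\in[a,b]$ (one-sided derivatives at the endpoints). *)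

theory Defs
  imports "HOL-Analysis.Analysis"
begin

(* Real functions on [a,b] are represented by total functions on the reals of which only the
   values at points of {a..b} matter: every condition below quantifies over points of {a..b} only. *)

(* In (B) the filter "at 0 within S" does not contain the point 0 itself, and S restricts h to
   x + h in [a,b], so the limit is one-sided at x = a and x = b. *)
definition is_integral_function ::
  "real \<Rightarrow> real \<Rightarrow> (real \<Rightarrow> real) \<Rightarrow> (real \<Rightarrow> real \<Rightarrow> real) \<Rightarrow> bool" where
  "is_integral_function a b \<rho> I \<longleftrightarrow>
     (\<forall>x\<in>{a..b}. \<forall>y\<in>{a..b}. \<forall>z\<in>{a..b}. I x y + I y z = I x z) \<and>
     (\<forall>x\<in>{a..b}. ((\<lambda>h. (I x (x + h) - \<rho> x * h) / h) \<longlongrightarrow> 0)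
                    (at 0 within {h. x + h \<in> {a..b}}))"

definition has_axiomatic_integral :: "real \<Rightarrow> real \<Rightarrow> (real \<Rightarrow> real) \<Rightarrow> bool" where
  "has_axiomatic_integral a b \<rho> \<longleftrightarrow> (\<exists>I. is_integral_function a b \<rho> I)"

definition is_antiderivative ::
  "real \<Rightarrow> real \<Rightarrow> (real \<Rightarrow> real) \<Rightarrow> (real \<Rightarrow> real) \<Rightarrow> bool" where
  "is_antiderivative a b \<rho> R \<longleftrightarrow>
     (\<forall>x\<in>{a..b}. (R has_real_derivative \<rho> x) (at x within {a..b}))"

definition has_antiderivative :: "real \<Rightarrow> real \<Rightarrow> (real \<Rightarrow> real) \<Rightarrow> bool" where
  "has_antiderivative a b \<rho> \<longleftrightarrow> (\<exists>R. is_antiderivative a b \<rho> R)"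

end

theory Submission
  imports Defs
begin

text \<open>Everything reduces to one antiderivative \<open>R\<close>. The differences
  \<open>R y - R x\<close> telescope, which gives (A), and (B) for them is differentiability of
  \<open>R\<close> with the error term written out. Continuity of \<open>\<rho>\<close> supplies
  such an \<open>R\<close> through the fundamental theorem of calculus.\<close>

lemma antiderivative_imp_integral_function:
  assumes "is_antiderivative a b \<rho> R"
  shows "is_integral_function a b \<rho> (\<lambda>x y. R y - R x)"
  unfolding is_integral_function_def
proof (intro conjI ballI)
  fix x assume x: "x \<in> {a..b}"
  let ?F = "at 0 within {h. x + h \<in> {a..b}}"
  have "((\<lambda>y. (R y - R x) / (y - x)) \<longlongrightarrow> \<rho> x) (at x within {a..b})"
    using assms x by (simp add: is_antiderivative_def has_field_derivative_iff)
  \<comment> \<open>Substituting \<open>y = x + h\<close> respects the punctured, one-sided limits: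
    \<open>h\<close> nonzero gives \<open>y\<close> different from \<open>x\<close>.\<close>
  moreover have "filterlim (\<lambda>h. x + h) (at x within {a..b}) ?F"
    unfolding filterlim_at
    by (auto simp: eventually_at_filter intro!: tendsto_eq_intros)
  ultimately have "((\<lambda>h. (R (x + h) - R x) / h) \<longlongrightarrow> \<rho> x) ?F"
    by (auto dest: filterlim_compose)
  from tendsto_diff[OF this tendsto_const[of "\<rho> x"]]
  have "((\<lambda>h. (R (x + h) - R x) / h - \<rho> x) \<longlongrightarrow> 0) ?F"
    by simp
  \<comment> \<open>The two quotients agree only for nonzero \<open>h\<close> in general, since
    division by 0 yields 0; the filter excludes \<open>h = 0\<close>.\<close>
  then show "((\<lambda>h. (R (x + h) - R x - \<rho> x * h) / h) \<longlongrightarrow> 0) ?F"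
    by (rule Lim_transform_eventually)
      (auto simp: eventually_at_filter diff_divide_distrib)
qed simp

theorem theorem3p2:
  fixes a b :: real and \<rho> :: "real \<Rightarrow> real"
  assumes "a < b"
    and "continuous_on {a..b} \<rho>"
  shows "has_axiomatic_integral a b \<rho> \<and> has_antiderivative a b \<rho>"
proof -
  \<comment> \<open>The witness is the gauge integral with variable upper endpoint.\<close>
  have "is_antiderivative a b \<rho> (\<lambda>x. integral {a..x} \<rho>)"
    unfolding is_antiderivative_def
    using integral_has_real_derivative[OF assms(2)] by blast
  then show ?thesis
    unfolding has_axiomatic_integral_def has_antiderivative_def
    using antiderivative_imp_integral_function by blast
qed

end
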